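(* Let $(X,\mathcal{B})$ be a topological state space, let $P$ be a weakly continuous stochastic kernel on $(X,\mathcal B)$, and let $A\subseteq X$ be a compact set. Then the largest absorbing subset $\mathrm{l.a.s.}(A)$ of $A$ is a compact set, and the following statements are equivalent: (1) $m(A)<\infty$; (2) $\mathcal{I}_A^n$ is a contraction on $\mathbb{B}$ for some finite $n$; (3) the equation $f=\mathcal{I}_A f$ has a unique solution $f\in\mathbb{B}$; (4) $u(x;A)=0$ for all $x\in X$; (5) the set $A$ is simple, i.e. $A_\infty=\emptyset$.
   Context: A state space $(X,\mathcal B)$ is called topological if $X$ is a Borel subset of a Polish space and $\mathcal B$ is the Borel $\sigma$-algebra of $X$. A stochastic kernel $P:X\times\mathcal B\to[0,1]$ is such that $P(\cdot,B)$ is measurable for each $B\in\mathcal B$ and $P(x,\cdot)$ is a probability measure for each $x\in X$. $\mathbb B$ is the Banach space of bounded measurable functions $f:X\to\mathbb R$ with norm $\|f\|=\sup_{x\in X}|f(x)|$. The transition operator is $Pf(x)=\int_X f(y)P(x,\mathrm dy)$ for $f\in\mathbb B$. $P$ is weakly continuous (Feller) if $Pf$ is upper semi-continuous whenever $f\in\mathbb B$ is upper semi-continuous. For $A\in\mathcal B$ the invariance operator is $\mathcal I_A f(x)=1_A(x)\,Pf(x)$. A linear operator $\mathcal J$ on $\mathbb B$ is a contraction if $\|\mathcal J\|:=\sup_{\|f\|\le 1}\|\mathcal Jf\|<1$. Let $\mathbf x=(\mathbf x_n)_{n\ge0}$ be the discrete-time Markov process with kernel $P$, with law $\mathsf P_x$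 when $\mathbf x_0=x$, and for $D\in\mathcal B$ let $\tau_D=\inf\{n\ge0:\mathbf x_n\in D\}$ (with $\inf\emptyset=\infty$). The invariance value functions are $u_n(x;A)=\mathsf P_x(\tau_{A^c}>n)$ and $u(x;A)=\mathsf P_x(\tau_{A^c}=\infty)$; equivalently $u_0(\cdot;A)=1_A$, $u_{n+1}(\cdot;A)=\mathcal I_A u_n(\cdot;A)$, and $u=\lim_n u_n$ pointwise. Put $m(A)=\inf\{m\ge0:\|u_m(\cdot;A)\|<1\}$, with $\inf\emptyset=\infty$. Put $A_n=\{x\in X:u_n(x;A)=1\}$ for $n\ge 0$ and $A_\infty=\bigcap_{n\ge0}A_n$. A set $D\in\mathcal B$ is absorbing if $P(x,D)=1$ for all $x\in D$. $\mathrm{l.a.s.}(A)$ denotes the largest (with respect to inclusion) absorbing subset of $A$; it exists for every $A\in\mathcal B$ and equals $A_\infty$. A set $A$ is simple if $\mathrm{l.a.s.}(A)=\emptyset$, i.e. it has no non-empty absorbing subsets, and non-simple otherwise. *)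

theory Defs
  imports "HOL-Probability.Probability"
begin

abbreviation borel_of :: "'a::polish_space set \<Rightarrow> 'a measure" where
  "borel_of X \<equiv> restrict_space borel X"

definition stochastic_kernel :: "'a::polish_space set \<Rightarrow> ('a \<Rightarrow> 'a measure) \<Rightarrow> bool" where
  "stochastic_kernel X P \<longleftrightarrow> P \<in> measurable (borel_of X) (prob_algebra (borel_of X))"

text \<open>Functions on \<open>X\<close> are represented as elements of \<^const>\<open>extensional\<close> \<open>X\<close>, so that HOL equality
  of two of them is equality on \<open>X\<close>.\<close>

definition bounded_measurable :: "'a::polish_space set \<Rightarrow> ('a \<Rightarrow> real) set" where
  "bounded_measurable X = {f \<in> extensional X \<inter> borel_measurable (borel_of X). bounded (f ` X)}"

text \<open>Norms take values in \<^typ>\<open>ennreal\<close>: the supremum over an empty \<open>X\<close> is then \<open>0\<close>, and an unbounded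
  operator has norm \<open>\<infinity>\<close>.\<close>

definition sup_norm :: "'a set \<Rightarrow> ('a \<Rightarrow> real) \<Rightarrow> ennreal" where
  "sup_norm X f = (SUP x\<in>X. ennreal \<bar>f x\<bar>)"

definition linear_operator ::
  "'a::polish_space set \<Rightarrow> (('a \<Rightarrow> real) \<Rightarrow> ('a \<Rightarrow> real)) \<Rightarrow> bool" where
  "linear_operator X J \<longleftrightarrow>
     J \<in> bounded_measurable X \<rightarrow> bounded_measurable X \<and>
     (\<forall>f\<in>bounded_measurable X. \<forall>g\<in>bounded_measurable X. \<forall>a b.
        J (\<lambda>x\<in>X. a * f x + b * g x) = (\<lambda>x\<in>X. a * J f x + b * J g x))"

definition operator_norm ::
  "'a::polish_space set \<Rightarrow> (('a \<Rightarrow> real) \<Rightarrow> ('a \<Rightarrow> real)) \<Rightarrow> ennreal" where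
  "operator_norm X J = (SUP f\<in>{f \<in> bounded_measurable X. sup_norm X f \<le> 1}. sup_norm X (J f))"

definition contraction ::
  "'a::polish_space set \<Rightarrow> (('a \<Rightarrow> real) \<Rightarrow> ('a \<Rightarrow> real)) \<Rightarrow> bool" where
  "contraction X J \<longleftrightarrow> linear_operator X J \<and> operator_norm X J < 1"

definition transition_op ::
  "'a set \<Rightarrow> ('a \<Rightarrow> 'a measure) \<Rightarrow> ('a \<Rightarrow> real) \<Rightarrow> ('a \<Rightarrow> real)" where
  "transition_op X P f = (\<lambda>x\<in>X. \<integral>y. f y \<partial>P x)"

definition invariance_op ::
  "'a set \<Rightarrow> ('a \<Rightarrow> 'a measure) \<Rightarrow> 'a set \<Rightarrow> ('a \<Rightarrow> real) \<Rightarrow> ('a \<Rightarrow> real)" where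
  "invariance_op X P A f = (\<lambda>x\<in>X. indicator A x * transition_op X P f x)"

definition upper_semicontinuous_on :: "'a::topological_space set \<Rightarrow> ('a \<Rightarrow> real) \<Rightarrow> bool" where
  "upper_semicontinuous_on X f \<longleftrightarrow> (\<forall>c. openin (top_of_set X) {x \<in> X. f x < c})"

definition weakly_continuous :: "'a::polish_space set \<Rightarrow> ('a \<Rightarrow> 'a measure) \<Rightarrow> bool" where
  "weakly_continuous X P \<longleftrightarrow>
     (\<forall>f\<in>bounded_measurable X.
        upper_semicontinuous_on X f \<longrightarrow> upper_semicontinuous_on X (transition_op X P f))"

text \<open>The process is the coordinate process on the path space \<open>X\<^sup>\<nat>\<close>, and its law is the
  Ionescu-Tulcea measure: coordinate \<open>0\<close> equals \<open>x\<close>, and given the coordinates up to \<open>n\<close>,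
  coordinate \<open>Suc n\<close> has law \<open>P (\<omega> n)\<close>.\<close>

fun path_kernel ::
  "'a::polish_space set \<Rightarrow> ('a \<Rightarrow> 'a measure) \<Rightarrow> 'a \<Rightarrow> nat \<Rightarrow> (nat \<Rightarrow> 'a) \<Rightarrow> 'a measure" where
  "path_kernel X P x 0 \<omega> = return (borel_of X) x"
| "path_kernel X P x (Suc n) \<omega> = P (\<omega> n)"

definition path_law ::
  "'a::polish_space set \<Rightarrow> ('a \<Rightarrow> 'a measure) \<Rightarrow> 'a \<Rightarrow> (nat \<Rightarrow> 'a) measure" where
  "path_law X P x =
     projective_family.lim UNIV (Ionescu_Tulcea.CI (path_kernel X P x) (\<lambda>_. borel_of X))
       (\<lambda>_. borel_of X)"

lemma Ionescu_Tulcea_path_kernel: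
  assumes P: "stochastic_kernel X P" and x: "x \<in> X"
  shows "Ionescu_Tulcea (path_kernel X P x) (\<lambda>_. borel_of X)"
proof (rule Ionescu_Tulcea.intro)
  have meas: "P \<in> measurable (borel_of X) (subprob_algebra (borel_of X))"
    using P unfolding stochastic_kernel_def by (rule measurable_prob_algebraD)
  have sp: "space (borel_of X) = X"
    by (simp add: space_restrict_space)
  show "path_kernel X P x i \<in>
      measurable (PiM {0..<i} (\<lambda>_. borel_of X)) (subprob_algebra (borel_of X))" for i
  proof (cases i)
    case 0
    have "return (borel_of X) x \<in> space (subprob_algebra (borel_of X))"
      using x sp by (intro measurable_space[OF return_measurable]) simp
    then show ?thesis
      using 0 by (simp add: path_kernel.simps(1)[abs_def])
  next
    case (Suc n)
    have "(\<lambda>\<omega>. \<omega> n) \<in> measurable (PiM {0..<i} (\<lambda>_. borel_of X)) (borel_of X)"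
      using Suc by (intro measurable_component_singleton) simp
    from measurable_compose[OF this meas] show ?thesis
      using Suc by (simp add: path_kernel.simps(2)[abs_def])
  qed
  show "prob_space (path_kernel X P x i \<omega>)"
    if "\<omega> \<in> space (PiM {0..<i} (\<lambda>_. borel_of X))" for i \<omega>
  proof (cases i)
    case 0
    then show ?thesis
      using x sp by (simp add: prob_space_return)
  next
    case (Suc n)
    then have "\<omega> n \<in> space (borel_of X)"
      using that by (auto simp: space_PiM PiE_iff)
    then have "P (\<omega> n) \<in> space (prob_algebra (borel_of X))"
      using P unfolding stochastic_kernel_def by (rule measurable_space[rotated])
    then show ?thesis
      using Suc by (simp add: space_prob_algebra)
  qed
qed

definition hitting_time :: "'a set \<Rightarrow> (nat \<Rightarrow> 'a) \<Rightarrow> enat" where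
  "hitting_time D \<omega> = Inf {enat n | n. \<omega> n \<in> D}"

definition inv_value ::
  "'a::polish_space set \<Rightarrow> ('a \<Rightarrow> 'a measure) \<Rightarrow> 'a set \<Rightarrow> nat \<Rightarrow> 'a \<Rightarrow> real" where
  "inv_value X P A n x =
     measure (path_law X P x) {\<omega> \<in> space (path_law X P x). hitting_time (X - A) \<omega> > enat n}"

definition inv_value_inf ::
  "'a::polish_space set \<Rightarrow> ('a \<Rightarrow> 'a measure) \<Rightarrow> 'a set \<Rightarrow> 'a \<Rightarrow> real" where
  "inv_value_inf X P A x =
     measure (path_law X P x) {\<omega> \<in> space (path_law X P x). hitting_time (X - A) \<omega> = \<infinity>}"

definition m_index :: "'a::polish_space set \<Rightarrow> ('a \<Rightarrow> 'a measure) \<Rightarrow> 'a set \<Rightarrow> enat" where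
  "m_index X P A = Inf {enat m | m. sup_norm X (inv_value X P A m) < 1}"

definition one_set :: "'a::polish_space set \<Rightarrow> ('a \<Rightarrow> 'a measure) \<Rightarrow> 'a set \<Rightarrow> nat \<Rightarrow> 'a set" where
  "one_set X P A n = {x \<in> X. inv_value X P A n x = 1}"

definition one_set_inf :: "'a::polish_space set \<Rightarrow> ('a \<Rightarrow> 'a measure) \<Rightarrow> 'a set \<Rightarrow> 'a set" where
  "one_set_inf X P A = (\<Inter>n. one_set X P A n)"

definition absorbing :: "'a::polish_space set \<Rightarrow> ('a \<Rightarrow> 'a measure) \<Rightarrow> 'a set \<Rightarrow> bool" where
  "absorbing X P D \<longleftrightarrow> D \<in> sets (borel_of X) \<and> (\<forall>x\<in>D. measure (P x) D = 1)"

definition las :: "'a::polish_space set \<Rightarrow> ('a \<Rightarrow> 'a measure) \<Rightarrow> 'a set \<Rightarrow> 'a set" where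
  "las X P A = (GREATEST D. absorbing X P D \<and> D \<subseteq> A)"

definition simple_set :: "'a::polish_space set \<Rightarrow> ('a \<Rightarrow> 'a measure) \<Rightarrow> 'a set \<Rightarrow> bool" where
  "simple_set X P A \<longleftrightarrow> las X P A = {}"

end

theory Submission
  imports Defs
begin

text \<open>
  Let \<open>u\<^sub>n = \<I>\<^sub>A\<^sup>n 1\<^sub>A\<close>. The Markov property identifies it with the probability of staying in \<open>A\<close> up to
  time \<open>n\<close>. Since \<open>\<bar>\<I>\<^sub>A\<^sup>n\<^sup>+\<^sup>1 f\<bar> \<le> c u\<^sub>n\<close> for \<open>\<bar>f\<bar> \<le> c\<close>, a bound \<open>u\<^sub>m \<le> q < 1\<close> is equivalent to an iterate
  being a contraction, and it forces every fixed point to vanish, in particular the pointwise limit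
  \<open>u\<close>, which is a fixed point by dominated convergence. If \<open>u = 0\<close> then no point has \<open>u\<^sub>n = 1\<close> for all
  \<open>n\<close>. Conversely, \<open>u\<^sub>n\<close> is upper semicontinuous, so the sets \<open>{x \<in> A. u\<^sub>n x \<ge> 1 - 1/(n+1)}\<close> are compact;
  they decrease to \<open>A\<^sub>\<infinity>\<close>, and if \<open>A\<^sub>\<infinity>\<close> is empty then one of them is empty.
\<close>

section \<open>Sup norms and hitting times\<close>

lemma sup_norm_le_iff:
  "0 \<le> c \<Longrightarrow> sup_norm X f \<le> ennreal c \<longleftrightarrow> (\<forall>x\<in>X. \<bar>f x\<bar> \<le> c)"
  by (simp add: sup_norm_def SUP_le_iff)

lemma sup_norm_less_1E:
  assumes "sup_norm X f < 1"
  obtains q where "0 \<le> q" "q < 1" "\<And>x. x \<in> X \<Longrightarrow> \<bar>f x\<bar> \<le> q"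
proof
  let ?q = "enn2real (sup_norm X f)"
  have q: "ennreal ?q = sup_norm X f"
    using assms by (intro ennreal_enn2real) (auto intro: less_trans)
  then show "?q < 1"
    using assms by (metis ennreal_less_one_iff)
  show "\<bar>f x\<bar> \<le> ?q" if "x \<in> X" for x
    using sup_norm_le_iff[of ?q X f] q that by simp
qed simp

lemma sup_norm_less_1I:
  assumes "0 \<le> q" "q < 1" "\<And>x. x \<in> X \<Longrightarrow> \<bar>f x\<bar> \<le> q"
  shows "sup_norm X f < 1"
proof -
  have "sup_norm X f \<le> ennreal q"
    using assms by (simp add: sup_norm_le_iff)
  also have "\<dots> < 1"
    using assms by simp
  finally show ?thesis .
qed

lemma sup_norm_mono:
  "(\<And>x. x \<in> X \<Longrightarrow> \<bar>f x\<bar> \<le> \<bar>g x\<bar>) \<Longrightarrow> sup_norm X f \<le> sup_norm X g"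
  unfolding sup_norm_def by (intro SUP_mono) (auto intro: ennreal_leI)

lemma hitting_time_greater_iff:
  assumes "\<And>i. \<omega> i \<in> X"
  shows "enat n < hitting_time (X - A) \<omega> \<longleftrightarrow> (\<forall>i\<le>n. \<omega> i \<in> A)"
proof -
  \<comment> \<open>A strict bound below all elements need not be strict for an infimum; over
    \<open>enat\<close> it becomes \<open>enat (Suc n) \<le> Inf\<close>, which can be tested on
    each element.\<close>
  have "enat n < hitting_time (X - A) \<omega> \<longleftrightarrow> (\<forall>i. \<omega> i \<in> X - A \<longrightarrow> Suc n \<le> i)"
    by (auto simp: hitting_time_def Suc_ile_eq[symmetric] le_Inf_iff)
  then show ?thesis
    using assms by (auto simp: not_less_eq_eq)
qed

lemma hitting_time_infinity_iff:
  assumes "\<And>i. \<omega> i \<in> X"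
  shows "hitting_time (X - A) \<omega> = \<infinity> \<longleftrightarrow> (\<forall>i. \<omega> i \<in> A)"
proof -
  have "hitting_time (X - A) \<omega> = \<infinity> \<longleftrightarrow> (\<forall>n. enat n < hitting_time (X - A) \<omega>)"
    by (cases "hitting_time (X - A) \<omega>") auto
  then show ?thesis
    using assms by (auto simp: hitting_time_greater_iff)
qed

section \<open>Stochastic kernels and bounded measurable functions\<close>

locale stochastic_kernel_set =
  fixes X :: "'a::polish_space set" and P :: "'a \<Rightarrow> 'a measure" and A :: "'a set"
  assumes kernel: "stochastic_kernel X P"
    and A_sets: "A \<in> sets (borel_of X)"
begin

abbreviation "I \<equiv> invariance_op X P A"

text \<open>Analytic form of \<open>inv_value\<close>; \<open>inv_value_eq\<close> identifies the
  two on \<open>X\<close>. Restricting the indicator to \<open>X\<close> makes it extensional, so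
  all iterates lie in \<open>bounded_measurable X\<close>.\<close>

definition u :: "nat \<Rightarrow> 'a \<Rightarrow> real" where
  "u n = (I ^^ n) (\<lambda>x\<in>X. indicator A x)"

lemma space_borel_of: "space (borel_of X) = X"
  by (simp add: space_restrict_space)

lemma A_subset: "A \<subseteq> X"
  using sets.sets_into_space[OF A_sets] by (simp add: space_borel_of)

lemma kernel_measurable: "P \<in> measurable (borel_of X) (subprob_algebra (borel_of X))"
  using kernel unfolding stochastic_kernel_def by (rule measurable_prob_algebraD)

lemma
  assumes "x \<in> X"
  shows prob_space_P: "prob_space (P x)" and sets_P: "sets (P x) = sets (borel_of X)"
    and space_P: "space (P x) = X"
proof -
  have "P x \<in> space (prob_algebra (borel_of X))"
    using kernel assms unfolding stochastic_kernel_def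
    by (intro measurable_space[of P "borel_of X"]) (auto simp: space_borel_of)
  then show "prob_space (P x)" "sets (P x) = sets (borel_of X)"
    by (auto simp: space_prob_algebra)
  then show "space (P x) = X"
    using sets_eq_imp_space_eq space_borel_of by metis
qed

lemma bounded_measurable_iff:
  "f \<in> bounded_measurable X \<longleftrightarrow>
    f \<in> extensional X \<and> f \<in> borel_measurable (borel_of X) \<and> (\<exists>c. \<forall>x\<in>X. \<bar>f x\<bar> \<le> c)"
  by (auto simp: bounded_measurable_def bounded_iff)

lemma restrict_bounded_measurable:
  assumes "f \<in> borel_measurable (borel_of X)" "\<And>x. x \<in> X \<Longrightarrow> \<bar>f x\<bar> \<le> c"
  shows "restrict f X \<in> bounded_measurable X"
proof -
  have "restrict f X \<in> borel_measurable (borel_of X)"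
    using assms(1) by (subst measurable_cong[of _ _ f]) (auto simp: space_borel_of)
  then show ?thesis
    using assms(2) by (auto simp: bounded_measurable_iff)
qed

lemma bounded_measurable_measurable:
  "f \<in> bounded_measurable X \<Longrightarrow> f \<in> borel_measurable (borel_of X)"
  by (simp add: bounded_measurable_iff)

lemma bounded_measurable_boundedE:
  assumes "f \<in> bounded_measurable X"
  obtains c where "0 \<le> c" "\<And>x. x \<in> X \<Longrightarrow> \<bar>f x\<bar> \<le> c"
proof -
  from assms obtain c where "\<And>x. x \<in> X \<Longrightarrow> \<bar>f x\<bar> \<le> c"
    by (auto simp: bounded_measurable_iff)
  then show thesis
    by (intro that[of "\<bar>c\<bar>"]) force+
qed

lemma indicator_bounded_measurable: "(\<lambda>x\<in>X. indicator A x) \<in> bounded_measurable X"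
  using A_sets by (intro restrict_bounded_measurable[of _ 1]) auto

lemma linear_bounded_measurable:
  assumes "f \<in> bounded_measurable X" "g \<in> bounded_measurable X"
  shows "(\<lambda>x\<in>X. a * f x + b * g x) \<in> bounded_measurable X"
proof -
  obtain c d where c: "\<And>x. x \<in> X \<Longrightarrow> \<bar>f x\<bar> \<le> c" and d: "\<And>x. x \<in> X \<Longrightarrow> \<bar>g x\<bar> \<le> d"
    using assms by (metis bounded_measurable_boundedE)
  show ?thesis
  proof (rule restrict_bounded_measurable)
    show "(\<lambda>x. a * f x + b * g x) \<in> borel_measurable (borel_of X)"
      using assms by (intro borel_measurable_add borel_measurable_times borel_measurable_const
          bounded_measurable_measurable)
    show "\<bar>a * f x + b * g x\<bar> \<le> \<bar>a\<bar> * c + \<bar>b\<bar> * d" if "x \<in> X" for x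
    proof -
      have "\<bar>a * f x + b * g x\<bar> \<le> \<bar>a\<bar> * \<bar>f x\<bar> + \<bar>b\<bar> * \<bar>g x\<bar>"
        by (metis abs_mult abs_triangle_ineq)
      also have "\<dots> \<le> \<bar>a\<bar> * c + \<bar>b\<bar> * d"
        using c[OF that] d[OF that] by (intro add_mono mult_left_mono) auto
      finally show ?thesis .
    qed
  qed
qed

lemma integrable_P:
  assumes "f \<in> bounded_measurable X" "x \<in> X"
  shows "integrable (P x) f"
proof -
  interpret prob_space "P x" by (rule prob_space_P) fact
  obtain c where c: "\<And>x. x \<in> X \<Longrightarrow> \<bar>f x\<bar> \<le> c"
    using assms by (metis bounded_measurable_boundedE)
  show ?thesis
  proof (rule integrable_const_bound)
    show "AE y in P x. norm (f y) \<le> c"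
      using c assms by (auto simp: space_P)
    show "f \<in> borel_measurable (P x)"
      using bounded_measurable_measurable[OF assms(1)] sets_P[OF assms(2)]
      by (simp cong: measurable_cong_sets)
  qed
qed

section \<open>The invariance operator\<close>

lemma I_apply: "x \<in> X \<Longrightarrow> I f x = indicator A x * (\<integral>y. f y \<partial>P x)"
  by (simp add: invariance_op_def transition_op_def)

lemma I_mono:
  assumes "f \<in> bounded_measurable X" "g \<in> bounded_measurable X"
    and "\<And>y. y \<in> X \<Longrightarrow> f y \<le> g y" "x \<in> X"
  shows "I f x \<le> I g x"
  unfolding I_apply[OF assms(4)] using assms
  by (intro mult_left_mono integral_mono integrable_P) (auto simp: space_P)

lemma I_abs_le:
  assumes "f \<in> bounded_measurable X" "g \<in> bounded_measurable X"
    and "\<And>y. y \<in> X \<Longrightarrow> \<bar>f y\<bar> \<le> g y" "x \<in> X"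
  shows "\<bar>I f x\<bar> \<le> I g x"
proof -
  have "\<bar>\<integral>y. f y \<partial>P x\<bar> \<le> (\<integral>y. g y \<partial>P x)"
    using assms
    by (intro order_trans[OF integral_abs_bound integral_mono] integrable_abs integrable_P)
      (auto simp: space_P)
  then show ?thesis
    using assms by (simp add: I_apply abs_mult mult_left_mono)
qed

text \<open>Averaging against a probability measure preserves the bound. The factor
  \<open>indicator A x\<close>, which is \<open>u 0 x\<close>, is kept so that this can serve as the
  base case of \<open>I_power_abs_le\<close>.\<close>

lemma I_abs_le_const:
  assumes "f \<in> bounded_measurable X" "\<And>y. y \<in> X \<Longrightarrow> \<bar>f y\<bar> \<le> c" "x \<in> X"
  shows "\<bar>I f x\<bar> \<le> c * indicator A x"
proof -
  interpret prob_space "P x" by (rule prob_space_P) fact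
  have "\<bar>\<integral>y. f y \<partial>P x\<bar> \<le> (\<integral>y. c \<partial>P x)"
    using assms
    by (intro order_trans[OF integral_abs_bound integral_mono] integrable_abs integrable_P[of f]
        integrable_const) (auto simp: space_P)
  then have "\<bar>\<integral>y. f y \<partial>P x\<bar> \<le> c"
    by (simp add: prob_space)
  then show ?thesis
    using assms by (auto simp: I_apply indicator_def)
qed

lemma I_bounded_measurable:
  assumes "f \<in> bounded_measurable X"
  shows "I f \<in> bounded_measurable X"
proof -
  obtain c where c: "0 \<le> c" "\<And>x. x \<in> X \<Longrightarrow> \<bar>f x\<bar> \<le> c"
    using assms by (metis bounded_measurable_boundedE)
  let ?g = "\<lambda>x. indicator A x * (\<integral>y. f y \<partial>P x)"
  have eq: "I f = restrict ?g X"
    by (auto simp: fun_eq_iff invariance_op_def transition_op_def)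
  show ?thesis
    unfolding eq
  proof (rule restrict_bounded_measurable)
    have "(\<lambda>x. \<integral>y. f y \<partial>P x) \<in> borel_measurable (borel_of X)"
      by (rule measurable_compose[OF kernel_measurable
            integral_measurable_subprob_algebra[OF bounded_measurable_measurable[OF assms]]])
    then show "?g \<in> borel_measurable (borel_of X)"
      using A_sets by (intro borel_measurable_times borel_measurable_indicator)
    show "\<bar>?g x\<bar> \<le> c" if "x \<in> X" for x
      using I_abs_le_const[OF assms c(2) that] that c(1)
      by (auto simp: I_apply indicator_def split: if_splits)
  qed
qed

lemma I_linear:
  assumes "f \<in> bounded_measurable X" "g \<in> bounded_measurable X"
  shows "I (\<lambda>x\<in>X. a * f x + b * g x) = (\<lambda>x\<in>X. a * I f x + b * I g x)"
proof
  fix x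
  show "I (\<lambda>x\<in>X. a * f x + b * g x) x = (\<lambda>x\<in>X. a * I f x + b * I g x) x"
  proof (cases "x \<in> X")
    case True
    have "(\<integral>y. (\<lambda>x\<in>X. a * f x + b * g x) y \<partial>P x) = (\<integral>y. a * f y + b * g y \<partial>P x)"
      using True by (intro Bochner_Integration.integral_cong) (auto simp: space_P)
    also have "\<dots> = a * (\<integral>y. f y \<partial>P x) + b * (\<integral>y. g y \<partial>P x)"
      using integrable_P[OF assms(1) True] integrable_P[OF assms(2) True] by simp
    finally show ?thesis
      using True by (simp add: I_apply algebra_simps)
  qed (simp add: invariance_op_def)
qed

lemma linear_operator_I_power: "linear_operator X (I ^^ n)"
proof (induction n)
  case 0
  then show ?case by (simp add: linear_operator_def)
next
  case (Suc n)
  then show ?case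
    by (auto simp: linear_operator_def I_bounded_measurable I_linear Pi_iff)
qed

lemma I_power_bounded_measurable:
  "f \<in> bounded_measurable X \<Longrightarrow> (I ^^ n) f \<in> bounded_measurable X"
  using linear_operator_I_power[of n] by (auto simp: linear_operator_def)

section \<open>The iterates \<open>u n\<close> and the decay of fixed points\<close>

lemma u_0: "u 0 = (\<lambda>x\<in>X. indicator A x)"
  by (simp add: u_def)

lemma u_Suc: "u (Suc n) = I (u n)"
  by (simp add: u_def)

lemma u_bounded_measurable: "u n \<in> bounded_measurable X"
  unfolding u_def by (intro I_power_bounded_measurable indicator_bounded_measurable)

lemma zero_bounded_measurable: "(\<lambda>x\<in>X. 0) \<in> bounded_measurable X"
  by (rule restrict_bounded_measurable[of _ 0]) auto

lemma I_zero: "I (\<lambda>x\<in>X. 0) = (\<lambda>x\<in>X. 0)"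
  using I_linear[OF zero_bounded_measurable zero_bounded_measurable, of 0 0] by simp

lemma u_nonneg: "x \<in> X \<Longrightarrow> 0 \<le> u n x"
proof (induction n arbitrary: x)
  case (Suc n)
  then show ?case
    by (auto simp: u_Suc I_apply space_P intro!: mult_nonneg_nonneg Bochner_Integration.integral_nonneg)
qed (simp add: u_0)

text \<open>The first step holds because \<open>u 0\<close> is bounded by 1 and \<open>P x\<close>
  has mass one; monotonicity of \<open>I\<close> carries it to all later iterates.\<close>

lemma u_Suc_le: "x \<in> X \<Longrightarrow> u (Suc n) x \<le> u n x"
proof (induction n arbitrary: x)
  case 0
  show ?case
    using I_abs_le_const[OF u_bounded_measurable, of 0 1 x] 0
    by (simp add: u_0 u_Suc)
next
  case (Suc n)
  then show ?case
    unfolding u_Suc[of "Suc n"] u_Suc[of n]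
    by (intro I_mono) (auto simp: u_bounded_measurable I_bounded_measurable u_Suc)
qed

lemma u_antimono: "x \<in> X \<Longrightarrow> m \<le> n \<Longrightarrow> u n x \<le> u m x"
  by (rule lift_Suc_antimono_le[of "\<lambda>n. u n x"]) (auto intro: u_Suc_le)

lemma u_le_indicator: "x \<in> X \<Longrightarrow> u n x \<le> indicator A x"
  using u_antimono[of x 0 n] by (simp add: u_0)

lemma u_le_1: "x \<in> X \<Longrightarrow> u n x \<le> 1"
  by (meson u_le_indicator indicator_le_1 order_trans)

text \<open>One application of \<open>I\<close> turns the constant bound \<open>c\<close> into
  \<open>c * u 0\<close>, and each further one turns \<open>c * u n\<close> into
  \<open>c * u (Suc n)\<close>. Hence the power of \<open>I\<close> is one ahead of the index of
  \<open>u\<close>.\<close>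

lemma I_power_abs_le:
  assumes "f \<in> bounded_measurable X" "\<And>y. y \<in> X \<Longrightarrow> \<bar>f y\<bar> \<le> c" "x \<in> X"
  shows "\<bar>(I ^^ Suc n) f x\<bar> \<le> c * u n x"
  using assms(3)
proof (induction n arbitrary: x)
  case 0
  then show ?case
    using I_abs_le_const[OF assms(1,2)] by (simp add: u_0)
next
  case (Suc n)
  \<comment> \<open>The zero summand gives the bound the two-term shape of
    \<open>I_linear\<close>.\<close>
  let ?g = "\<lambda>x\<in>X. c * u n x + 0 * u n x"
  have "\<bar>I ((I ^^ Suc n) f) x\<bar> \<le> I ?g x"
    using Suc
    by (intro I_abs_le I_power_bounded_measurable assms linear_bounded_measurable
        u_bounded_measurable) (auto simp del: funpow.simps)
  also have "\<dots> = c * I (u n) x"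
    unfolding I_linear[OF u_bounded_measurable u_bounded_measurable] using Suc by simp
  finally show ?case
    by (simp add: u_Suc)
qed

text \<open>A fixed point equals all its iterates, so \<open>I_power_abs_le\<close> at the power
  \<open>Suc m\<close> improves any constant bound on it by the factor \<open>q\<close>. Repetition
  drives the bound to zero.\<close>

lemma fixed_point_eq_0:
  assumes f: "f \<in> bounded_measurable X" "f = I f"
    and q: "0 \<le> q" "q < 1" "\<And>x. x \<in> X \<Longrightarrow> u m x \<le> q"
    and x: "x \<in> X"
  shows "f x = 0"
proof -
  have pow: "(I ^^ n) f = f" for n
    by (induction n) (simp_all add: f(2)[symmetric])
  obtain c where c: "0 \<le> c" "\<And>x. x \<in> X \<Longrightarrow> \<bar>f x\<bar> \<le> c"
    using f by (metis bounded_measurable_boundedE)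
  have "\<bar>f x\<bar> \<le> c * q ^ k" if "x \<in> X" for k x
    using that
  proof (induction k arbitrary: x)
    case (Suc k)
    have "\<bar>f x\<bar> \<le> c * q ^ k * u m x"
      using I_power_abs_le[OF f(1) Suc.IH Suc.prems, of m] unfolding pow by simp
    also have "\<dots> \<le> c * q ^ k * q"
      using q c Suc.prems by (intro mult_left_mono) auto
    finally show ?case by (simp add: mult_ac)
  qed (simp add: c)
  moreover have "(\<lambda>k. c * q ^ k) \<longlonglongrightarrow> 0"
    using q by (intro tendsto_mult_right_zero LIMSEQ_realpow_zero) auto
  ultimately have "\<bar>f x\<bar> \<le> 0"
    using x by (intro LIMSEQ_le_const) auto
  then show ?thesis by simp
qed

section \<open>The path law and the Markov property\<close>

lemma Ionescu_Tulcea_path: "x \<in> X \<Longrightarrow> Ionescu_Tulcea (path_kernel X P x) (\<lambda>_. borel_of X)"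
  by (rule Ionescu_Tulcea_path_kernel[OF kernel])

lemma nn_integral_P_measurable:
  assumes "f \<in> borel_measurable (borel_of X)"
  shows "(\<lambda>x. \<integral>\<^sup>+y. f y \<partial>P x) \<in> borel_measurable (borel_of X)"
  by (rule measurable_compose[OF kernel_measurable nn_integral_measurable_subprob_algebra[OF assms]])

text \<open>The operator \<open>I\<close> on \<open>ennreal\<close> functions, where the path
  induction needs no integrability.\<close>

definition nn_I :: "('a \<Rightarrow> ennreal) \<Rightarrow> 'a \<Rightarrow> ennreal" where
  "nn_I f x = indicator A x * (\<integral>\<^sup>+y. f y \<partial>P x)"

text \<open>The Ionescu-Tulcea construction only exposes the last step of a path, whereas \<open>u\<close> recurses on the
  first one. Integrating out the last coordinate replaces \<open>g\<close> by \<open>\<lambda>z. \<integral>\<^sup>+y. indicator A y * g y \<partial>P z\<close>, so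
  the induction needs an arbitrary function \<open>g\<close> of the final state.\<close>

lemma nn_integral_path:
  assumes x: "x \<in> X" and "g \<in> borel_measurable (borel_of X)"
  shows "(\<integral>\<^sup>+\<omega>. indicator {\<omega>. \<forall>i\<le>n. \<omega> i \<in> A} \<omega> * g (\<omega> n)
      \<partial>Ionescu_Tulcea.C (path_kernel X P x) (\<lambda>_. borel_of X) 0 (Suc n) (\<lambda>_. undefined)) =
    (nn_I ^^ n) (\<lambda>y. indicator A y * g y) x"
  using assms(2)
proof (induction n arbitrary: g)
  interpret IT: Ionescu_Tulcea "path_kernel X P x" "\<lambda>_. borel_of X"
    by (rule Ionescu_Tulcea_path) fact
  let ?M = "\<lambda>n. PiM {0..<n} (\<lambda>_. borel_of X)"
  let ?C = "\<lambda>n. IT.C 0 n (\<lambda>_. undefined)"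
  \<comment> \<open>\<open>?C (Suc n)\<close> binds \<open>?C n\<close> with the kernel
    \<open>IT.eP n\<close>, which appends coordinate \<open>n\<close> to a path.\<close>
  have step: "(\<integral>\<^sup>+\<omega>. f \<omega> \<partial>?C (Suc n)) =
      (\<integral>\<^sup>+\<omega>. \<integral>\<^sup>+y. f (fun_upd \<omega> n y) \<partial>path_kernel X P x n \<omega> \<partial>?C n)"
    if "f \<in> borel_measurable (?M (Suc n))" for f n
  proof -
    have "(\<integral>\<^sup>+\<omega>. f \<omega> \<partial>?C (Suc n)) = (\<integral>\<^sup>+\<omega>. \<integral>\<^sup>+\<omega>'. f \<omega>' \<partial>IT.eP n \<omega> \<partial>?C n)"
      unfolding IT.C.simps add_0
      by (rule nn_integral_bind[OF that])
        (simp add: measurable_cong_sets[OF IT.sets_C refl])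
    also have "\<dots> = (\<integral>\<^sup>+\<omega>. \<integral>\<^sup>+y. f (fun_upd \<omega> n y) \<partial>path_kernel X P x n \<omega> \<partial>?C n)"
      using that by (intro nn_integral_cong IT.nn_integral_eP) (simp_all add: IT.space_C)
    finally show ?thesis .
  qed
  have meas: "(\<lambda>\<omega>. indicator {\<omega>. \<forall>i\<le>n. \<omega> i \<in> A} \<omega> * g (\<omega> n)) \<in> borel_measurable (?M (Suc n))"
    if [measurable]: "g \<in> borel_measurable (borel_of X)" for g :: "'a \<Rightarrow> ennreal" and n
  proof -
    note A_sets[measurable]
    have [measurable]: "(\<lambda>\<omega>. \<omega> i) \<in> measurable (?M (Suc n)) (borel_of X)" if "i \<le> n" for i
      using that by (intro measurable_component_singleton) simp
    \<comment> \<open>As a finite product over coordinates the indicator is measurable factor by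
      factor.\<close>
    have "(\<lambda>\<omega>. (\<Prod>i\<le>n. indicator A (\<omega> i)) * g (\<omega> n)) \<in> borel_measurable (?M (Suc n))"
      by measurable
    also have "(\<lambda>\<omega>. (\<Prod>i\<le>n. indicator A (\<omega> i)) * g (\<omega> n)) =
        (\<lambda>\<omega>. indicator {\<omega>. \<forall>i\<le>n. \<omega> i \<in> A} \<omega> * g (\<omega> n))"
      by (auto simp: fun_eq_iff indicator_def)
    finally show ?thesis .
  qed
  {
    case 0
    have "(\<integral>\<^sup>+\<omega>. indicator {\<omega>. \<forall>i\<le>0. \<omega> i \<in> A} \<omega> * g (\<omega> 0) \<partial>?C (Suc 0)) =
        (\<integral>\<^sup>+\<omega>. \<integral>\<^sup>+y. indicator A y * g y \<partial>return (borel_of X) x \<partial>?C 0)"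
      unfolding step[OF meas[OF 0]] by (intro nn_integral_cong) (simp_all add: indicator_def)
    also have "\<dots> = (\<integral>\<^sup>+\<omega>. indicator A x * g x \<partial>?C 0)"
      using x 0 A_sets by (subst nn_integral_return) (auto simp: space_borel_of)
    \<comment> \<open>The integrand no longer depends on the path, and the law of the empty path has
      mass one.\<close>
    also have "\<dots> = indicator A x * g x"
      by (simp add: prob_space.emeasure_space_1[OF IT.prob_space_C] del: IT.C.simps)
    finally show ?case
      by simp
  next
    case (Suc n)
    have split_last: "indicator {\<omega>. \<forall>i\<le>Suc n. \<omega> i \<in> A} (fun_upd \<omega> (Suc n) y) *
          g (fun_upd \<omega> (Suc n) y (Suc n)) =
        indicator {\<omega>. \<forall>i\<le>n. \<omega> i \<in> A} \<omega> * (indicator A y * g y)" for \<omega> y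
      by (auto simp: le_Suc_eq indicator_def)
    have "(\<integral>\<^sup>+\<omega>. indicator {\<omega>. \<forall>i\<le>Suc n. \<omega> i \<in> A} \<omega> * g (\<omega> (Suc n)) \<partial>?C (Suc (Suc n))) =
       (\<integral>\<^sup>+\<omega>. \<integral>\<^sup>+y. indicator {\<omega>. \<forall>i\<le>n. \<omega> i \<in> A} \<omega> * (indicator A y * g y) \<partial>P (\<omega> n)
          \<partial>?C (Suc n))"
      unfolding step[OF meas[OF Suc.prems]] split_last path_kernel.simps ..
    also have "\<dots> = (\<integral>\<^sup>+\<omega>. indicator {\<omega>. \<forall>i\<le>n. \<omega> i \<in> A} \<omega> *
        (\<integral>\<^sup>+y. indicator A y * g y \<partial>P (\<omega> n)) \<partial>?C (Suc n))"
    proof (rule nn_integral_cong)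
      fix \<omega> assume "\<omega> \<in> space (?C (Suc n))"
      then have "\<omega> n \<in> X"
        by (auto simp: IT.space_C space_PiM space_borel_of PiE_iff simp del: IT.C.simps)
      then have "(\<lambda>y. indicator A y * g y) \<in> borel_measurable (P (\<omega> n))"
        using A_sets Suc.prems by (simp add: sets_P cong: measurable_cong_sets)
      then show "(\<integral>\<^sup>+y. indicator {\<omega>. \<forall>i\<le>n. \<omega> i \<in> A} \<omega> * (indicator A y * g y) \<partial>P (\<omega> n)) =
          indicator {\<omega>. \<forall>i\<le>n. \<omega> i \<in> A} \<omega> * (\<integral>\<^sup>+y. indicator A y * g y \<partial>P (\<omega> n))"
        by (rule nn_integral_cmult)
    qed
    \<comment> \<open>The induction hypothesis multiplies the integrated function by
      \<open>indicator A\<close> once more, which completes it to a value of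
      \<open>nn_I\<close>.\<close>
    also have "\<dots> = (nn_I ^^ n) (nn_I (\<lambda>y. indicator A y * g y)) x"
      using A_sets Suc.prems
      by (subst Suc.IH) (auto simp: nn_I_def[abs_def] intro!: nn_integral_P_measurable)
    finally show ?case
      by (simp add: funpow_swap1)
  }
qed

lemma nn_I_u: "x \<in> X \<Longrightarrow> (nn_I ^^ n) (indicator A) x = ennreal (u n x)"
proof (induction n arbitrary: x)
  case 0
  then show ?case by (simp add: u_0 ennreal_indicator)
next
  case (Suc n)
  have "(\<integral>\<^sup>+y. (nn_I ^^ n) (indicator A) y \<partial>P x) = (\<integral>\<^sup>+y. ennreal (u n y) \<partial>P x)"
    using Suc by (intro nn_integral_cong) (auto simp: space_P)
  also have "\<dots> = ennreal (\<integral>y. u n y \<partial>P x)"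
    using Suc.prems
    by (intro nn_integral_eq_integral integrable_P u_bounded_measurable)
      (auto simp: space_P u_nonneg)
  finally show ?case
    using Suc.prems by (cases "x \<in> A") (simp_all add: nn_I_def[abs_def] u_Suc I_apply)
qed

text \<open>Staying in \<open>A\<close> up to time \<open>n\<close> is a cylinder event, so its
  probability is that of a finite-dimensional law, given by \<open>nn_integral_path\<close> with
  \<open>g = 1\<close>. These events decrease to that of never leaving \<open>A\<close>, and
  continuity from above gives the limit.\<close>

lemma
  assumes "x \<in> X"
  shows inv_value_eq: "inv_value X P A n x = u n x"
    and inv_value_LIMSEQ: "(\<lambda>n. u n x) \<longlonglongrightarrow> inv_value_inf X P A x"
proof -
  interpret IT: Ionescu_Tulcea "path_kernel X P x" "\<lambda>_. borel_of X"
    by (rule Ionescu_Tulcea_path) fact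
  let ?M = "\<lambda>n. PiM {0..<n} (\<lambda>_. borel_of X)"
  let ?C = "\<lambda>n. IT.C 0 n (\<lambda>_. undefined)"
  have law: "path_law X P x = IT.PF.lim"
    by (simp add: path_law_def)
  \<comment> \<open>The marginal on the empty index set is a probability measure, and a push-forward
    preserves total mass.\<close>
  interpret L: prob_space "path_law X P x"
  proof (rule prob_space_distrD)
    show "(\<lambda>\<omega>. restrict \<omega> {}) \<in> measurable (path_law X P x) (PiM {} (\<lambda>_. borel_of X))"
      unfolding measurable_cong_sets[OF IT.PF.sets_lim refl] law
      by (intro measurable_restrict) simp
    show "prob_space (distr (path_law X P x) (PiM {} (\<lambda>_. borel_of X)) (\<lambda>\<omega>. restrict \<omega> {}))"
      unfolding law by (subst IT.distr_lim) (simp_all add: IT.PF.prob_space_P)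
  qed
  have space_law: "space (path_law X P x) = (\<Pi>\<^sub>E i\<in>UNIV. X)"
    by (simp add: law space_PiM space_borel_of)
  define F where "F n = {\<omega> \<in> space (?M (Suc n)). \<forall>i\<le>n. \<omega> i \<in> A}" for n
  define E where "E n = {\<omega> \<in> space (path_law X P x). enat n < hitting_time (X - A) \<omega>}" for n
  have F: "F n \<in> sets (?M (Suc n))" for n
  proof -
    note A_sets[measurable]
    have [measurable]: "(\<lambda>\<omega>. \<omega> i) \<in> measurable (?M (Suc n)) (borel_of X)" if "i \<le> n" for i
      using that by (intro measurable_component_singleton) simp
    show ?thesis
      unfolding F_def by measurable
  qed
  \<comment> \<open>Times \<open>0\<close> to \<open>n\<close> inclusive occupy \<open>Suc n\<close>
    coordinates.\<close>
  have E: "E n = IT.PF.emb UNIV {0..<Suc n} (F n)" for n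
    by (auto simp: E_def F_def prod_emb_def space_law space_PiM space_borel_of
        hitting_time_greater_iff PiE_iff Pi_iff less_Suc_eq_le)
  have E_sets: "E n \<in> sets (path_law X P x)" for n
    unfolding E law using F by simp
  have "emeasure (path_law X P x) (E n) = emeasure (?C (Suc n)) (F n)" for n
  proof -
    have "emeasure (path_law X P x) (E n) = emeasure (IT.CI {0..<Suc n}) (F n)"
      unfolding law E by (rule IT.lim) (simp_all add: F del: IT.C.simps)
    also have "\<dots> = emeasure (?C (Suc n)) (IT.PF.emb {0..<Suc n} {0..<Suc n} (F n))"
      by (rule IT.emeasure_CI) (simp_all add: F)
    also have "IT.PF.emb {0..<Suc n} {0..<Suc n} (F n) = F n"
      using sets.sets_into_space[OF F[of n]]
      by (auto simp: prod_emb_def space_PiM F_def PiE_restrict)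
    finally show ?thesis .
  qed
  also have "emeasure (?C (Suc n)) (F n) = ennreal (u n x)" for n
  proof -
    have "emeasure (?C (Suc n)) (F n) = (\<integral>\<^sup>+\<omega>. indicator (F n) \<omega> \<partial>?C (Suc n))"
      using F[of n] by (simp add: IT.sets_C del: IT.C.simps)
    also have "\<dots> = (\<integral>\<^sup>+\<omega>. indicator {\<omega>. \<forall>i\<le>n. \<omega> i \<in> A} \<omega> * 1 \<partial>?C (Suc n))"
      by (intro nn_integral_cong) (auto simp: F_def IT.space_C indicator_def simp del: IT.C.simps)
    also have "\<dots> = (nn_I ^^ n) (indicator A) x"
      using assms by (subst nn_integral_path) simp_all
    finally show ?thesis
      using assms by (simp add: nn_I_u del: IT.C.simps)
  qed
  finally have E_u: "measure (path_law X P x) (E n) = u n x" for n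
    using u_nonneg[OF assms] by (simp add: measure_def)
  then show "inv_value X P A n x = u n x"
    by (simp add: inv_value_def E_def)
  have "{\<omega> \<in> space (path_law X P x). hitting_time (X - A) \<omega> = \<infinity>} = (\<Inter>n. E n)"
    by (auto simp: E_def space_law PiE_iff hitting_time_infinity_iff hitting_time_greater_iff)
      blast
  then show "(\<lambda>n. u n x) \<longlonglongrightarrow> inv_value_inf X P A x"
    unfolding inv_value_inf_def E_u[symmetric] using E_sets
    by (auto intro!: L.finite_Lim_measure_decseq decseq_SucI simp: E_def Suc_ile_eq less_imp_le
        intro: less_trans[of "enat _" "enat (Suc _)"])
qed

section \<open>Monotone powers and the limiting value function\<close>

lemma I_power_mono:
  assumes "f \<in> bounded_measurable X" "g \<in> bounded_measurable X"
    and "\<And>y. y \<in> X \<Longrightarrow> f y \<le> g y" "x \<in> X"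
  shows "(I ^^ n) f x \<le> (I ^^ n) g x"
  using assms(4)
  by (induction n arbitrary: x) (auto intro!: I_mono I_power_bounded_measurable assms)

lemma inv_value_inf_bounded_measurable: "restrict (inv_value_inf X P A) X \<in> bounded_measurable X"
proof (rule restrict_bounded_measurable)
  show "inv_value_inf X P A \<in> borel_measurable (borel_of X)"
    by (rule borel_measurable_LIMSEQ_real[of _ u])
      (auto simp: space_borel_of intro: inv_value_LIMSEQ bounded_measurable_measurable
        u_bounded_measurable)
  show "\<bar>inv_value_inf X P A x\<bar> \<le> 1" if "x \<in> X" for x
    by (rule LIMSEQ_le_const2[OF tendsto_rabs[OF inv_value_LIMSEQ[OF that]]])
      (use that in \<open>auto simp: u_nonneg u_le_1\<close>)
qed

text \<open>Dominated convergence with the bound 1 lets \<open>I\<close> pass to the limit, so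
  \<open>u (Suc n) x\<close> tends to both sides.\<close>

lemma inv_value_inf_fixed_point:
  "restrict (inv_value_inf X P A) X = I (restrict (inv_value_inf X P A) X)" (is "?v = I ?v")
proof
  fix x
  show "?v x = I ?v x"
  proof (cases "x \<in> X")
    case True
    interpret prob_space "P x" by (rule prob_space_P) fact
    have "(\<lambda>n. \<integral>y. u n y \<partial>P x) \<longlonglongrightarrow> (\<integral>y. ?v y \<partial>P x)"
    proof (rule integral_dominated_convergence[where w="\<lambda>_. 1"])
      show "?v \<in> borel_measurable (P x)" "u n \<in> borel_measurable (P x)" for n
        using integrable_P[OF _ True] inv_value_inf_bounded_measurable u_bounded_measurable
        by (blast intro: borel_measurable_integrable)+
      show "AE y in P x. (\<lambda>n. u n y) \<longlonglongrightarrow> ?v y"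
        using inv_value_LIMSEQ True by (auto simp: space_P)
      show "AE y in P x. norm (u n y) \<le> 1" for n
        using True by (auto simp: space_P u_nonneg u_le_1)
    qed simp
    then have "(\<lambda>n. u (Suc n) x) \<longlonglongrightarrow> I ?v x"
      using True by (auto simp: u_Suc I_apply intro!: tendsto_mult_left)
    with LIMSEQ_Suc[OF inv_value_LIMSEQ[OF True]] True show ?thesis
      by (auto dest: LIMSEQ_unique)
  qed (simp add: invariance_op_def)
qed

section \<open>The largest absorbing subset\<close>

lemma one_set_inf_eq: "one_set_inf X P A = {x \<in> X. \<forall>n. u n x = 1}"
  by (auto simp: one_set_inf_def one_set_def inv_value_eq)

lemma one_set_inf_subset: "one_set_inf X P A \<subseteq> A"
proof
  fix x assume "x \<in> one_set_inf X P A"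
  then have "x \<in> X" "u 0 x = 1"
    by (auto simp: one_set_inf_eq)
  then show "x \<in> A"
    by (simp add: u_0 indicator_eq_1_iff)
qed

text \<open>A function bounded by 1 has mean 1 under a probability measure only if it is 1 almost
  everywhere. For \<open>x\<close> in the set, \<open>u (Suc n) x = 1\<close> is the mean of
  \<open>u n\<close> under \<open>P x\<close>; the countably many exceptional null sets are then
  united.\<close>

lemma one_set_inf_absorbing: "absorbing X P (one_set_inf X P A)"
  unfolding absorbing_def
proof (intro conjI ballI)
  have "{x \<in> space (borel_of X). \<forall>n. u n x = 1} \<in> sets (borel_of X)"
    using bounded_measurable_measurable[OF u_bounded_measurable] by measurable
  then show sets: "one_set_inf X P A \<in> sets (borel_of X)"
    by (simp add: one_set_inf_eq space_borel_of)
  fix x assume x: "x \<in> one_set_inf X P A"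
  then have xX: "x \<in> X" and xA: "x \<in> A" and ux: "\<And>n. u n x = 1"
    using one_set_inf_subset by (auto simp: one_set_inf_eq)
  interpret prob_space "P x" by (rule prob_space_P) fact
  have "AE y in P x. u n y = 1" for n
  proof -
    have int: "integrable (P x) (u n)"
      by (rule integrable_P[OF u_bounded_measurable xX])
    then have "(\<integral>y. 1 - u n y \<partial>P x) = 0"
      using ux[of "Suc n"] xX xA by (simp add: u_Suc I_apply prob_space)
    then have "AE y in P x. 1 - u n y = 0"
      using int xX by (subst (asm) integral_nonneg_eq_0_iff_AE) (auto simp: space_P u_le_1)
    then show ?thesis by simp
  qed
  then have "AE y in P x. \<forall>n. u n y = 1"
    by (simp add: AE_all_countable)
  then have "AE y in P x. y \<in> one_set_inf X P A"
    by (rule AE_mp) (use xX in \<open>auto simp: one_set_inf_eq space_P\<close>)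
  then show "measure (P x) (one_set_inf X P A) = 1"
    using sets xX by (subst prob_eq_1) (auto simp: sets_P)
qed

text \<open>From a point of \<open>D\<close> the next state is almost surely in \<open>D\<close>, so
  the value 1, which \<open>u 0\<close> takes on \<open>A\<close>, is reproduced on \<open>D\<close>
  at each step.\<close>

lemma absorbing_subset_one_set_inf:
  assumes D: "absorbing X P D" "D \<subseteq> A"
  shows "D \<subseteq> one_set_inf X P A"
proof -
  have "u n x = 1" if "x \<in> D" for n x
    using that
  proof (induction n arbitrary: x)
    case 0
    then show ?case
      using D A_subset by (auto simp: u_0)
  next
    case (Suc n)
    then have x: "x \<in> X" "x \<in> A"
      using D A_subset by auto
    interpret prob_space "P x" by (rule prob_space_P) fact
    have "AE y in P x. y \<in> D"
      using D(1) Suc.prems x by (subst prob_eq_1[symmetric]) (auto simp: absorbing_def sets_P)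
    then have "AE y in P x. u n y = 1"
      using Suc.IH by auto
    then have "(\<integral>y. u n y \<partial>P x) = (\<integral>y. 1 \<partial>P x)"
      using integrable_P[OF u_bounded_measurable x(1)] by (intro integral_cong_AE) auto
    then show ?case
      using x by (simp add: u_Suc I_apply prob_space)
  qed
  then show ?thesis
    using D A_subset by (auto simp: one_set_inf_eq)
qed

lemma las_eq: "las X P A = one_set_inf X P A"
  unfolding las_def
  by (rule Greatest_equality)
    (auto simp: one_set_inf_absorbing one_set_inf_subset
      dest: absorbing_subset_one_set_inf one_set_inf_subset[THEN subsetD])

section \<open>Implications valid for every measurable \<open>A\<close>\<close>

lemma m_index_finite_iff: "m_index X P A < \<infinity> \<longleftrightarrow> (\<exists>m. sup_norm X (u m) < 1)"
proof -
  have "sup_norm X (inv_value X P A m) = sup_norm X (u m)" for m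
    by (simp add: sup_norm_def inv_value_eq)
  then show ?thesis
    unfolding m_index_def Inf_less_iff by auto
qed

text \<open>The indices shift in one direction only: \<open>u m\<close> controls the power
  \<open>Suc m\<close> by \<open>I_power_abs_le\<close>, whereas the power \<open>n\<close> already
  controls \<open>u n\<close>.\<close>

lemma contraction_iff:
  "(\<exists>n. contraction X (I ^^ n)) \<longleftrightarrow> (\<exists>m. sup_norm X (u m) < 1)"
proof
  assume "\<exists>m. sup_norm X (u m) < 1"
  then obtain m where m: "sup_norm X (u m) < 1" ..
  have "operator_norm X (I ^^ Suc m) \<le> sup_norm X (u m)"
    unfolding operator_norm_def
  proof (rule SUP_least)
    fix f assume "f \<in> {f \<in> bounded_measurable X. sup_norm X f \<le> 1}"
    then have f: "f \<in> bounded_measurable X" "\<And>x. x \<in> X \<Longrightarrow> \<bar>f x\<bar> \<le> 1"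
      using sup_norm_le_iff[of 1 X f] by auto
    show "sup_norm X ((I ^^ Suc m) f) \<le> sup_norm X (u m)"
      using I_power_abs_le[OF f] by (intro sup_norm_mono) (auto simp: u_nonneg simp del: funpow.simps)
  qed
  then show "\<exists>n. contraction X (I ^^ n)"
    using m linear_operator_I_power unfolding contraction_def by (blast intro: le_less_trans)
next
  \<comment> \<open>The constant one lies in the unit ball and dominates the indicator of
    \<open>A\<close>, so its image dominates \<open>u n\<close>.\<close>
  let ?e = "\<lambda>x\<in>X. 1::real"
  assume "\<exists>n. contraction X (I ^^ n)"
  then obtain n where n: "operator_norm X (I ^^ n) < 1"
    by (auto simp: contraction_def)
  have e: "?e \<in> bounded_measurable X"
    by (rule restrict_bounded_measurable[of _ 1]) auto
  have "sup_norm X ?e \<le> 1"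
    using sup_norm_le_iff[of 1 X ?e] by simp
  with e have "sup_norm X ((I ^^ n) ?e) \<le> operator_norm X (I ^^ n)"
    unfolding operator_norm_def by (intro SUP_upper) (simp only: mem_Collect_eq simp_thms)
  have "\<bar>u n x\<bar> \<le> \<bar>(I ^^ n) ?e x\<bar>" if "x \<in> X" for x
  proof -
    have "u n x \<le> (I ^^ n) ?e x"
      unfolding u_def using that
      by (intro I_power_mono indicator_bounded_measurable e) auto
    then show ?thesis
      using u_nonneg[OF that, of n] by simp
  qed
  then have "sup_norm X (u n) \<le> sup_norm X ((I ^^ n) ?e)"
    by (rule sup_norm_mono)
  also note \<open>\<dots> \<le> operator_norm X (I ^^ n)\<close>
  finally show "\<exists>m. sup_norm X (u m) < 1"
    using n by (blast intro: le_less_trans)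
qed

text \<open>Zero is always a fixed point; the norm bound enters through
  \<open>fixed_point_eq_0\<close>, for uniqueness.\<close>

lemma ex1_fixed_point:
  assumes "sup_norm X (u m) < 1"
  shows "\<exists>!f. f \<in> bounded_measurable X \<and> f = I f"
proof (rule ex1I[of _ "\<lambda>x\<in>X. 0"])
  show "(\<lambda>x\<in>X. 0) \<in> bounded_measurable X \<and> (\<lambda>x\<in>X. 0) = I (\<lambda>x\<in>X. 0)"
    by (simp add: I_zero zero_bounded_measurable)
  fix f assume f: "f \<in> bounded_measurable X \<and> f = I f"
  from sup_norm_less_1E[OF assms]
  obtain q where q: "0 \<le> q" "q < 1" "\<And>x. x \<in> X \<Longrightarrow> \<bar>u m x\<bar> \<le> q"
    by blast
  have "f x = 0" if "x \<in> X" for x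
    using f q that by (intro fixed_point_eq_0[of f q m]) (auto dest: abs_le_D1)
  \<comment> \<open>Equality of functions also concerns points outside \<open>X\<close>, where
    extensionality fixes the value.\<close>
  moreover have "f \<in> extensional X"
    using f by (simp add: bounded_measurable_iff)
  ultimately show "f = (\<lambda>x\<in>X. 0)"
    by (auto simp: fun_eq_iff extensional_def)
qed

text \<open>The limiting value function and zero are both fixed points, so uniqueness identifies
  them.\<close>

lemma ex1_fixed_point_imp_inv_value_inf_eq_0:
  assumes "\<exists>!f. f \<in> bounded_measurable X \<and> f = I f" "x \<in> X"
  shows "inv_value_inf X P A x = 0"
proof -
  have "restrict (inv_value_inf X P A) X = (\<lambda>x\<in>X. 0)"
    using assms(1) inv_value_inf_bounded_measurable inv_value_inf_fixed_point
      zero_bounded_measurable I_zero by metis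
  then show ?thesis
    using assms(2) by (metis restrict_apply)
qed

lemma inv_value_inf_eq_0_imp_one_set_inf_empty:
  assumes "\<forall>x\<in>X. inv_value_inf X P A x = 0"
  shows "one_set_inf X P A = {}"
proof -
  have False if x: "x \<in> X" "\<And>n. u n x = 1" for x
  proof -
    have "(\<lambda>n. u n x) \<longlonglongrightarrow> 1"
      using x by simp
    with inv_value_LIMSEQ[OF x(1)] assms x(1) show False
      using LIMSEQ_unique by force
  qed
  then show ?thesis
    by (auto simp: one_set_inf_eq)
qed

end

section \<open>Compact sets and weakly continuous kernels\<close>

locale feller_kernel_compact_set =
  fixes X :: "'a::polish_space set" and P :: "'a \<Rightarrow> 'a measure" and A :: "'a set"
  assumes stochastic: "stochastic_kernel X P"
    and feller: "weakly_continuous X P"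
    and A_sub: "A \<subseteq> X" and A_compact: "compact A"

sublocale feller_kernel_compact_set \<subseteq> stochastic_kernel_set
proof
  show "stochastic_kernel X P" by (rule stochastic)
  have "A \<in> sets borel"
    using A_compact by (intro borel_closed compact_imp_closed)
  then show "A \<in> sets (borel_of X)"
    using A_sub by (auto simp: sets_restrict_space image_iff)
qed

context feller_kernel_compact_set
begin

text \<open>Below a level \<open>c \<le> 0\<close> there is no point, as the product is nonnegative.
  Below a positive level lie all points off \<open>A\<close>, which form a relatively open set since
  \<open>A\<close> is closed, together with the sublevel set of \<open>f\<close>.\<close>

lemma upper_semicontinuous_on_indicator_times:
  assumes f: "upper_semicontinuous_on X f" "\<And>x. x \<in> X \<Longrightarrow> 0 \<le> f x"
  shows "upper_semicontinuous_on X (\<lambda>x\<in>X. indicator A x * f x)"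
  unfolding upper_semicontinuous_on_def
proof
  fix c :: real
  let ?S = "{x \<in> X. (\<lambda>x\<in>X. indicator A x * f x) x < c}"
  show "openin (top_of_set X) ?S"
  proof (cases "c \<le> 0")
    case True
    then have "?S = {}"
      using f(2) by (force simp: indicator_def)
    then show ?thesis by simp
  next
    case False
    then have "?S = X \<inter> - A \<union> {x \<in> X. f x < c}"
      by (auto simp: indicator_def)
    moreover have "openin (top_of_set X) (X \<inter> - A)"
      using compact_imp_closed[OF A_compact] by (intro openin_open_Int) auto
    ultimately show ?thesis
      using f(1) by (simp add: upper_semicontinuous_on_def openin_Un)
  qed
qed

lemma u_upper_semicontinuous: "upper_semicontinuous_on X (u n)"
proof (induction n)
  case 0
  have "{x \<in> X. (1::real) < c} = (if 1 < c then X else {})" for c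
    by auto
  then have "upper_semicontinuous_on X (\<lambda>_. 1)"
    by (simp add: upper_semicontinuous_on_def)
  from upper_semicontinuous_on_indicator_times[OF this] show ?case
    by (simp add: u_0 restrict_def)
next
  case (Suc n)
  \<comment> \<open>The Feller property enters here.\<close>
  have "upper_semicontinuous_on X (transition_op X P (u n))"
    using feller Suc u_bounded_measurable by (simp add: weakly_continuous_def)
  moreover have "0 \<le> transition_op X P (u n) x" if "x \<in> X" for x
    using that
    by (auto simp: transition_op_def space_P u_nonneg intro!: Bochner_Integration.integral_nonneg)
  ultimately show ?case
    unfolding u_Suc invariance_op_def by (rule upper_semicontinuous_on_indicator_times)
qed

lemma compact_superlevel: "compact {x \<in> A. c \<le> u n x}"
proof -
  have "openin (top_of_set X) {x \<in> X. u n x < c}"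
    using u_upper_semicontinuous by (simp add: upper_semicontinuous_on_def)
  then obtain T where T: "open T" "{x \<in> X. u n x < c} = X \<inter> T"
    by (auto simp: openin_open)
  then have "{x \<in> A. c \<le> u n x} = A - T"
    using A_sub by (auto simp: set_eq_iff not_less[symmetric])
  then show ?thesis
    using T A_compact by (simp add: compact_diff)
qed

text \<open>Since \<open>u n \<le> 1\<close>, being equal to 1 is a superlevel condition, and
  superlevel sets in \<open>A\<close> are closed.\<close>

lemma compact_one_set_inf: "compact (one_set_inf X P A)"
proof -
  have "one_set_inf X P A = A \<inter> (\<Inter>n. {x \<in> A. 1 \<le> u n x})"
  proof (intro equalityI subsetI IntI INT_I CollectI)
    fix x assume "x \<in> A \<inter> (\<Inter>n. {x \<in> A. 1 \<le> u n x})"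
    then have "x \<in> X" "\<And>n. 1 \<le> u n x"
      using A_sub by auto
    then show "x \<in> one_set_inf X P A"
      using u_le_1 by (auto simp: one_set_inf_eq intro: antisym)
  qed (use one_set_inf_subset in \<open>auto simp: one_set_inf_eq\<close>)
  moreover have "closed (\<Inter>n. {x \<in> A. 1 \<le> u n x})"
    by (intro closed_INT ballI compact_imp_closed compact_superlevel)
  ultimately show ?thesis
    using A_compact by (simp add: compact_Int_closed)
qed

text \<open>If no superlevel set \<open>B n\<close> were empty, the finite intersection property
  would yield a point in all of them, and that point would have \<open>u m x = 1\<close> for every
  \<open>m\<close>.\<close>

lemma one_set_inf_empty_imp_sup_norm_u_less_1:
  assumes "one_set_inf X P A = {}"
  shows "\<exists>m. sup_norm X (u m) < 1"
proof -
  \<comment> \<open>The levels stay below 1, so one empty \<open>B n\<close> gives a uniform bound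
    below 1; they tend to 1, so a common point has value 1.\<close>
  define B where "B n = {x \<in> A. 1 - 1 / real (Suc n) \<le> u n x}" for n
  have anti: "B n \<subseteq> B m" if "m \<le> n" for m n
  proof
    fix x assume x: "x \<in> B n"
    then have "1 - 1 / real (Suc m) \<le> 1 - 1 / real (Suc n)" "u n x \<le> u m x"
      using that A_sub by (auto simp: B_def frac_le intro!: u_antimono)
    with x show "x \<in> B m"
      by (auto simp: B_def)
  qed
  have "\<exists>n. B n = {}"
  proof (rule ccontr)
    assume nonempty: "\<nexists>n. B n = {}"
    have "A \<inter> (\<Inter>n. B n) \<noteq> {}"
    proof (rule compact_imp_fip_image[OF A_compact])
      show "closed (B n)" for n
        unfolding B_def by (intro compact_imp_closed compact_superlevel)
      fix J :: "nat set" assume J: "finite J"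
      \<comment> \<open>The \<open>B n\<close> decrease, so the one of largest index lies in all
        others; inserting 0 provides an index when \<open>J\<close> is empty.\<close>
      have "B (Max (insert 0 J)) \<subseteq> A \<inter> (\<Inter>n\<in>J. B n)"
        using J by (intro Int_greatest INT_greatest anti Max_ge) (auto simp: B_def)
      then show "A \<inter> (\<Inter>n\<in>J. B n) \<noteq> {}"
        using nonempty by blast
    qed
    then obtain x where x: "x \<in> A" "\<And>n. x \<in> B n"
      by auto
    have "u m x = 1" for m
    proof (rule antisym)
      show "u m x \<le> 1"
        using x A_sub by (auto intro: u_le_1)
      \<comment> \<open>With \<open>m\<close> fixed, later levels also bound \<open>u m x\<close>
        from below because \<open>u n x \<le> u m x\<close>.\<close>
      have "1 - 1 / real (Suc n) \<le> u m x" if "m \<le> n" for n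
        using x(2)[of n] u_antimono[of x m n] that x(1) A_sub by (auto simp: B_def)
      moreover have "(\<lambda>n. 1 - 1 / real (Suc n)) \<longlonglongrightarrow> 1 - 0"
        by (intro tendsto_diff tendsto_const LIMSEQ_Suc lim_1_over_n)
      ultimately show "1 \<le> u m x"
        by (intro LIMSEQ_le_const2) auto
    qed
    with x A_sub have "x \<in> one_set_inf X P A"
      by (auto simp: one_set_inf_eq)
    with assms show False by simp
  qed
  then obtain n where n: "B n = {}" ..
  \<comment> \<open>On \<open>A\<close> this is the emptiness of \<open>B n\<close>; off
    \<open>A\<close> the function vanishes.\<close>
  have "\<bar>u n x\<bar> \<le> 1 - 1 / real (Suc n)" if "x \<in> X" for x
  proof (cases "x \<in> A")
    case True
    then have "u n x \<le> 1 - 1 / real (Suc n)"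
      using n by (force simp: B_def)
    then show ?thesis
      using u_nonneg[OF that, of n] by simp
  next
    case False
    then show ?thesis
      using u_nonneg[OF that, of n] u_le_indicator[OF that, of n] by simp
  qed
  then have "sup_norm X (u n) < 1"
    by (intro sup_norm_less_1I[of "1 - 1 / real (Suc n)"]) auto
  then show ?thesis ..
qed

end

theorem theorem1:
  fixes X A :: "'a::polish_space set" and P :: "'a \<Rightarrow> 'a measure"
  assumes "X \<in> sets borel"
    and "stochastic_kernel X P"
    and "weakly_continuous X P"
    and "A \<subseteq> X" and "compact A"
  shows "compact (las X P A) \<and>
    (m_index X P A < \<infinity> \<longleftrightarrow> (\<exists>n. contraction X (invariance_op X P A ^^ n))) \<and>
    (m_index X P A < \<infinity> \<longleftrightarrow> (\<exists>!f. f \<in> bounded_measurable X \<and> f = invariance_op X P A f)) \<and>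
    (m_index X P A < \<infinity> \<longleftrightarrow> (\<forall>x\<in>X. inv_value_inf X P A x = 0)) \<and>
    (m_index X P A < \<infinity> \<longleftrightarrow> simple_set X P A) \<and>
    (simple_set X P A \<longleftrightarrow> one_set_inf X P A = {})"
proof -
  interpret feller_kernel_compact_set X P A
    using assms by unfold_locales
  have "compact (las X P A)"
    by (simp add: las_eq compact_one_set_inf)
  moreover have "simple_set X P A \<longleftrightarrow> one_set_inf X P A = {}"
    by (simp add: simple_set_def las_eq)
  moreover have "m_index X P A < \<infinity> \<longleftrightarrow> (\<exists>n. contraction X (I ^^ n))"
    by (simp only: contraction_iff m_index_finite_iff)
  \<comment> \<open>From here the implications form a cycle: finite index, unique fixed point,
    vanishing limit, empty \<open>one_set_inf\<close>, finite index.\<close>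
  moreover have "m_index X P A < \<infinity> \<Longrightarrow> \<exists>!f. f \<in> bounded_measurable X \<and> f = I f"
    unfolding m_index_finite_iff by (erule exE) (rule ex1_fixed_point)
  moreover have "\<exists>!f. f \<in> bounded_measurable X \<and> f = I f \<Longrightarrow> \<forall>x\<in>X. inv_value_inf X P A x = 0"
    by (intro ballI ex1_fixed_point_imp_inv_value_inf_eq_0)
  moreover note inv_value_inf_eq_0_imp_one_set_inf_empty
  moreover have "one_set_inf X P A = {} \<Longrightarrow> m_index X P A < \<infinity>"
    using one_set_inf_empty_imp_sup_norm_u_less_1 by (simp only: m_index_finite_iff)
  ultimately show ?thesis
    by argo
qed

end
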